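(* Let $G$ be a finite simple connected graph with $n$ vertices and $m$ edges. Then $$\begin{aligned}F(G^{+--})={}&3(m+n-1)F(G)-\xi_4(G)-3\,\mathrm{ReZG}_3(G)-3(m+n-1)^2M_1(G)\\&+6(m+n-1)M_2(G)+m(m+n-1)^3+nm^3.\end{aligned}$$
   Context: For a finite simple graph $H$ with vertex set $V(H)$ and edge set $E(H)$, $d_H(v)$ denotes the degree of the vertex $v$ in $H$. The F-index of $H$ is $F(H)=\sum_{v\in V(H)} d_H(v)^3$. The first and second Zagreb indices are $M_1(H)=\sum_{v\in V(H)} d_H(v)^2$ and $M_2(H)=\sum_{uv\in E(H)} d_H(u)d_H(v)$. Further, $\xi_4(H)=\sum_{v\in V(H)} d_H(v)^4=\sum_{uv\in E(H)}[d_H(u)^3+d_H(v)^3]$ and $\mathrm{ReZG}_3(H)=\sum_{uv\in E(H)} d_H(u)d_H(v)[d_H(u)+d_H(v)]$. For $x,y,z\in\{+,-\}$, the total transformation graph $G^{xyz}$ is the simple graph with vertex set $V(G)\cup E(G)$ (disjoint union) in which two distinct elements $u,v$ are adjacent if and only if one of the following holds: (i) $u,v\in V(G)$, and $u,v$ are adjacent in $G$ if $x=+$, respectively not adjacent in $G$ if $x=-$; (ii) $u,v\in E(G)$, and $u,v$ are adjacent in $G$ (share an endpoint) if $y=+$, respectively not adjacent in $G$ if $y=-$; (iii) one of them is a vertex of $G$ and the other is an edge of $G$, and they are incident in $G$ if $z=+$, respectively not incident in $G$ if $z=-$. *)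

theory Defs
  imports Main
begin

text \<open>Undirected graphs are given by a vertex set and a set of edges, an edge being the
  two-element set of its endpoints.\<close>

record 'a ugraph =
  verts :: "'a set"
  edges :: "'a set set"

definition finite_simple_graph :: "'a ugraph \<Rightarrow> bool" where
  "finite_simple_graph H \<longleftrightarrow>
     finite (verts H) \<and> (\<forall>e \<in> edges H. e \<subseteq> verts H \<and> card e = 2)"

definition adjacent :: "'a ugraph \<Rightarrow> 'a \<Rightarrow> 'a \<Rightarrow> bool" where
  "adjacent H u v \<longleftrightarrow> u \<noteq> v \<and> {u, v} \<in> edges H"

definition edge_adjacent :: "'a set \<Rightarrow> 'a set \<Rightarrow> bool" where
  "edge_adjacent e f \<longleftrightarrow> e \<noteq> f \<and> e \<inter> f \<noteq> {}"

text \<open>The empty graph does not count as connected.\<close>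

definition connected_graph :: "'a ugraph \<Rightarrow> bool" where
  "connected_graph H \<longleftrightarrow>
     verts H \<noteq> {} \<and> (\<forall>u \<in> verts H. \<forall>v \<in> verts H. (adjacent H)\<^sup>*\<^sup>* u v)"

definition degree :: "'a ugraph \<Rightarrow> 'a \<Rightarrow> nat" where
  "degree H v = card {e \<in> edges H. v \<in> e}"

definition F_index :: "'a ugraph \<Rightarrow> nat" where
  "F_index H = (\<Sum>v \<in> verts H. degree H v ^ 3)"

definition zagreb1 :: "'a ugraph \<Rightarrow> nat" where
  "zagreb1 H = (\<Sum>v \<in> verts H. degree H v ^ 2)"

definition xi4 :: "'a ugraph \<Rightarrow> nat" where
  "xi4 H = (\<Sum>v \<in> verts H. degree H v ^ 4)"

text \<open>For an edge \<open>e = {u, v}\<close> of a simple graph, the product and the sum over \<open>w \<in> e\<close> of the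
  degrees of \<open>w\<close> are \<open>d(u) d(v)\<close> and \<open>d(u) + d(v)\<close>.\<close>

definition zagreb2 :: "'a ugraph \<Rightarrow> nat" where
  "zagreb2 H = (\<Sum>e \<in> edges H. \<Prod>w \<in> e. degree H w)"

definition ReZG3 :: "'a ugraph \<Rightarrow> nat" where
  "ReZG3 H = (\<Sum>e \<in> edges H. (\<Prod>w \<in> e. degree H w) * (\<Sum>w \<in> e. degree H w))"

datatype sign = Plus | Minus

fun signed :: "sign \<Rightarrow> bool \<Rightarrow> bool" where
  "signed Plus P = P"
| "signed Minus P = (\<not> P)"

text \<open>The elements of the total transformation graph are tagged: \<open>Inl\<close> marks a vertex and
  \<open>Inr\<close> an edge of the original graph.  The relation below is meant for distinct elements
  only.\<close>

fun transformation_rel ::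
  "sign \<Rightarrow> sign \<Rightarrow> sign \<Rightarrow> 'a ugraph \<Rightarrow> 'a + 'a set \<Rightarrow> 'a + 'a set \<Rightarrow> bool" where
  "transformation_rel x y z G (Inl u) (Inl v) = signed x (adjacent G u v)"
| "transformation_rel x y z G (Inr e) (Inr f) = signed y (edge_adjacent e f)"
| "transformation_rel x y z G (Inl u) (Inr f) = signed z (u \<in> f)"
| "transformation_rel x y z G (Inr e) (Inl v) = signed z (v \<in> e)"

definition total_transformation ::
  "sign \<Rightarrow> sign \<Rightarrow> sign \<Rightarrow> 'a ugraph \<Rightarrow> ('a + 'a set) ugraph" where
  "total_transformation x y z G =
     \<lparr>verts = verts G <+> edges G,
      edges = {{p, q} | p q. p \<in> verts G <+> edges G \<and> q \<in> verts G <+> edges G \<and>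
                             p \<noteq> q \<and> transformation_rel x y z G p q}\<rparr>"

lemma adjacent_total_transformation:
  "adjacent (total_transformation x y z G) p q \<longleftrightarrow>
     p \<in> verts G <+> edges G \<and> q \<in> verts G <+> edges G \<and> p \<noteq> q \<and>
     transformation_rel x y z G p q"
proof -
  have "transformation_rel x y z G q p = transformation_rel x y z G p q"
    by (cases p; cases q)
       (auto simp: adjacent_def edge_adjacent_def insert_commute Int_commute
         intro!: arg_cong[where f = "signed _"])
  then show ?thesis
    unfolding adjacent_def total_transformation_def by (auto simp: doubleton_eq_iff)
qed

lemma finite_simple_graph_total_transformation:
  assumes "finite_simple_graph G"
  shows "finite_simple_graph (total_transformation x y z G)"
proof -
  have "edges G \<subseteq> Pow (verts G)" "finite (verts G)"
    using assms by (auto simp: finite_simple_graph_def)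
  then have "finite (edges G)"
    by (meson finite_Pow_iff finite_subset)
  with \<open>finite (verts G)\<close> have "finite (verts G <+> edges G)"
    by simp
  moreover have "e \<subseteq> verts G <+> edges G \<and> card e = 2"
    if "e \<in> edges (total_transformation x y z G)" for e
  proof -
    from that obtain p q where "e = {p, q}" "p \<in> verts G <+> edges G"
        "q \<in> verts G <+> edges G" "p \<noteq> q"
      unfolding total_transformation_def ugraph.simps mem_Collect_eq by blast
    then show ?thesis
      by (simp only: insert_subset empty_subsetI card_2_iff) blast
  qed
  moreover have "verts (total_transformation x y z G) = verts G <+> edges G"
    by (simp only: total_transformation_def ugraph.simps)
  ultimately show ?thesis
    by (simp only: finite_simple_graph_def) blast
qed

end

theory Submission
  imports Defs
begin

text \<open>In \<open>G\<^bsup>+--\<^esup>\<close> a vertex \<open>v\<close> has \<open>d(v)\<close> neighbours among the vertices and \<open>m - d(v)\<close> among the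
  edges, hence degree \<open>m\<close>.  Two distinct edges of \<open>G\<close> share at most one endpoint, so an edge \<open>uv\<close>
  has degree \<open>(m + 1 - d(u) - d(v)) + (n - 2) = s - (d(u) + d(v))\<close> with \<open>s = m + n - 1\<close>.
  Expanding \<open>(s - (d(u) + d(v)))\<^sup>3\<close> and using \<open>\<Sum>\<^bsub>uv\<^esub> (g(u) + g(v)) = \<Sum>\<^bsub>v\<^esub> d(v) g(v)\<close> for
  \<open>g = d, d\<^sup>2, d\<^sup>3\<close> gives the formula.\<close>

lemma finite_edges:
  assumes "finite_simple_graph H"
  shows "finite (edges H)"
proof -
  have "edges H \<subseteq> Pow (verts H)" "finite (verts H)"
    using assms by (auto simp: finite_simple_graph_def)
  then show ?thesis
    by (meson finite_Pow_iff finite_subset)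
qed

lemma edge_doubletonE:
  assumes "finite_simple_graph H" "e \<in> edges H"
  obtains u v where "e = {u, v}" "u \<noteq> v" "u \<in> verts H" "v \<in> verts H"
proof -
  have "card e = 2" "e \<subseteq> verts H"
    using assms by (auto simp: finite_simple_graph_def)
  then show thesis
    using that by (auto simp: card_2_iff)
qed

lemma adjacent_in_verts:
  assumes "finite_simple_graph H" "adjacent H v w"
  shows "w \<in> verts H"
  using assms by (auto simp: finite_simple_graph_def adjacent_def)

text \<open>In a simple graph, sending \<open>w\<close> to \<open>{v, w}\<close> is a bijection from
  the neighbours of \<open>v\<close> to the edges at \<open>v\<close>. Degrees in a transformation
  graph can then be read off from its adjacency relation.\<close>

lemma degree_eq_card_neighbours:
  assumes "finite_simple_graph H"
  shows "degree H v = card {w. adjacent H v w}"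
proof -
  have "{e \<in> edges H. v \<in> e} = (\<lambda>w. {v, w}) ` {w. adjacent H v w}"
  proof (intro equalityI subsetI)
    fix e assume "e \<in> {e \<in> edges H. v \<in> e}"
    then have e: "e \<in> edges H" "v \<in> e"
      by auto
    obtain a b where "e = {a, b}" "a \<noteq> b"
      using edge_doubletonE[OF assms e(1)] by metis
    with e(2) obtain w where "e = {v, w}" "v \<noteq> w"
      by auto
    with e show "e \<in> (\<lambda>w. {v, w}) ` {w. adjacent H v w}"
      by (auto simp: adjacent_def)
  qed (auto simp: adjacent_def)
  moreover have "inj_on (\<lambda>w. {v, w}) {w. adjacent H v w}"
    by (auto simp: inj_on_def doubleton_eq_iff)
  ultimately show ?thesis
    by (simp add: degree_def card_image)
qed

text \<open>Double counting of incident pairs: \<open>g v\<close> occurs once for each edge through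
  \<open>v\<close>. Writing \<open>e\<close> as \<open>{w \<in> verts H. w \<in> e}\<close> allows
  the two sums to be interchanged.\<close>

lemma sum_edges_sum_endpoints:
  fixes g :: "'a \<Rightarrow> 'b::comm_semiring_1"
  assumes "finite_simple_graph H"
  shows "(\<Sum>e\<in>edges H. \<Sum>w\<in>e. g w) = (\<Sum>v\<in>verts H. of_nat (degree H v) * g v)"
proof -
  have "(\<Sum>e\<in>edges H. \<Sum>w\<in>e. g w) = (\<Sum>e\<in>edges H. \<Sum>w\<in>{w \<in> verts H. w \<in> e}. g w)"
    using assms by (intro sum.cong) (auto simp: finite_simple_graph_def)
  also have "\<dots> = (\<Sum>v\<in>verts H. \<Sum>e\<in>{e \<in> edges H. v \<in> e}. g v)"
    using assms by (intro sum.swap_restrict finite_edges) (auto simp: finite_simple_graph_def)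
  finally show ?thesis
    by (simp add: degree_def)
qed

text \<open>Inclusion-exclusion on the edges through either endpoint: only \<open>e\<close> itself
  contains both, which accounts for the \<open>+ 1\<close>.\<close>

lemma card_disjoint_edges:
  assumes G: "finite_simple_graph G" and e: "e \<in> edges G"
  shows "int (card {f \<in> edges G. f \<inter> e = {}}) =
    int (card (edges G)) + 1 - (\<Sum>w\<in>e. int (degree G w))"
proof -
  obtain u v where uv: "e = {u, v}" "u \<noteq> v"
    using edge_doubletonE[OF G e] by metis
  define A B where "A = {f \<in> edges G. u \<in> f}" and "B = {f \<in> edges G. v \<in> f}"
  have fin: "finite (edges G)" "finite A" "finite B"
    using finite_edges[OF G] by (auto simp: A_def B_def)
  have sub: "A \<union> B \<subseteq> edges G"
    by (auto simp: A_def B_def)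
  have "f = e" if "f \<in> edges G" "u \<in> f" "v \<in> f" for f
  proof -
    obtain a b where "f = {a, b}"
      using edge_doubletonE[OF G \<open>f \<in> edges G\<close>] by metis
    then show ?thesis
      using that uv by auto
  qed
  then have "A \<inter> B = {e}"
    using e uv unfolding A_def B_def by blast
  then have "card A + card B = card (A \<union> B) + 1"
    using card_Un_Int[OF fin(2,3)] by simp
  moreover have "{f \<in> edges G. f \<inter> e = {}} = edges G - (A \<union> B)"
    using uv by (auto simp: A_def B_def)
  moreover have "card (A \<union> B) \<le> card (edges G)"
    using fin(1) sub by (rule card_mono)
  moreover have "(\<Sum>w\<in>e. int (degree G w)) = int (card A) + int (card B)"
    using uv by (simp add: degree_def A_def B_def)
  ultimately show ?thesis
    using fin sub by (simp add: card_Diff_subset)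
qed

lemma degree_transformation_vertex:
  assumes G: "finite_simple_graph G" and v: "v \<in> verts G"
  shows "degree (total_transformation Plus y Minus G) (Inl v) = card (edges G)"
proof -
  let ?T = "total_transformation Plus y Minus G"
  let ?N = "{w. adjacent G v w}" and ?E = "{f \<in> edges G. v \<in> f}"
  have "\<not> adjacent G v v"
    by (simp add: adjacent_def)
  have N: "{q. adjacent ?T (Inl v) q} = ?N <+> (edges G - ?E)"
  proof (rule set_eqI)
    fix q
    show "q \<in> {q. adjacent ?T (Inl v) q} \<longleftrightarrow> q \<in> ?N <+> (edges G - ?E)"
      using v adjacent_in_verts[OF G] \<open>\<not> adjacent G v v\<close>
      by (cases q) (auto simp: adjacent_total_transformation)
  qed
  have fin: "finite ?N" "finite (edges G)"
    using G finite_edges[OF G] adjacent_in_verts[OF G]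
    by (auto simp: finite_simple_graph_def intro: finite_subset[of _ "verts G"])
  \<comment> \<open>The neighbours gained among the vertices balance the incident edges excluded by
    the third sign.\<close>
  have "card ?N = card ?E"
    using degree_eq_card_neighbours[OF G] by (metis degree_def)
  moreover have "card ?E \<le> card (edges G)"
    using fin by (intro card_mono) auto
  ultimately show ?thesis
    using fin
    by (simp add: degree_eq_card_neighbours finite_simple_graph_total_transformation G N
        card_Plus card_Diff_subset)
qed

lemma degree_transformation_edge:
  assumes G: "finite_simple_graph G" and e: "e \<in> edges G"
  shows "int (degree (total_transformation x Minus Minus G) (Inr e)) =
    int (card (edges G)) + int (card (verts G)) - 1 - (\<Sum>w\<in>e. int (degree G w))"
proof -
  let ?T = "total_transformation x Minus Minus G"
  let ?D = "{f \<in> edges G. f \<inter> e = {}}"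
  have e2: "e \<subseteq> verts G" "card e = 2" "finite (verts G)"
    using G e by (auto simp: finite_simple_graph_def)
  then have fin: "finite e" "e \<noteq> {}" "finite ?D"
    using finite_edges[OF G] by (auto intro: finite_subset)
  have N: "{q. adjacent ?T (Inr e) q} = (verts G - e) <+> ?D"
  proof (rule set_eqI)
    fix q
    show "q \<in> {q. adjacent ?T (Inr e) q} \<longleftrightarrow> q \<in> (verts G - e) <+> ?D"
      \<comment> \<open>As \<open>e\<close> is nonempty, it is not disjoint from itself, so
        \<open>?D\<close> already omits \<open>e\<close>.\<close>
      using e fin(2)
      by (cases q) (auto simp: adjacent_total_transformation edge_adjacent_def)
  qed
  \<comment> \<open>This makes the natural-number difference \<open>card (verts G) - card e\<close>
    exact under \<open>int\<close>.\<close>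
  have "card e \<le> card (verts G)"
    using e2 by (intro card_mono)
  then show ?thesis
    using e2 fin card_disjoint_edges[OF G e]
    by (simp add: degree_eq_card_neighbours finite_simple_graph_total_transformation G N
        card_Plus card_Diff_subset)
qed

theorem theorem7:
  fixes G :: "'a ugraph" and n m :: nat
  assumes "finite_simple_graph G"
    and "connected_graph G"
    and "n = card (verts G)"
    and "m = card (edges G)"
  shows "int (F_index (total_transformation Plus Minus Minus G)) =
      3 * (int m + int n - 1) * int (F_index G) - int (xi4 G) - 3 * int (ReZG3 G)
      - 3 * (int m + int n - 1) ^ 2 * int (zagreb1 G)
      + 6 * (int m + int n - 1) * int (zagreb2 G)
      + int m * (int m + int n - 1) ^ 3 + int n * int m ^ 3"
proof -
  note G = assms(1)
  let ?T = "total_transformation Plus Minus Minus G"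
  define d where "d v = int (degree G v)" for v
  define s where "s = int m + int n - 1"
  \<comment> \<open>Double counting raises the exponent by one, so \<open>S 1\<close>,
    \<open>S 2\<close>, \<open>S 3\<close> are the vertex sums of second, third and fourth
    powers.\<close>
  define S where "S k = (\<Sum>e\<in>edges G. \<Sum>w\<in>e. d w ^ k)" for k :: nat
  have S: "S k = (\<Sum>v\<in>verts G. d v ^ Suc k)" for k
    by (simp add: S_def d_def sum_edges_sum_endpoints[OF G])
  have indices: "int (zagreb1 G) = S 1" "int (F_index G) = S 2" "int (xi4 G) = S 3"
    by (simp_all add: S zagreb1_def F_index_def xi4_def d_def eval_nat_numeral)
  have M2: "int (zagreb2 G) = (\<Sum>e\<in>edges G. \<Prod>w\<in>e. d w)"
    and R: "int (ReZG3 G) = (\<Sum>e\<in>edges G. (\<Prod>w\<in>e. d w) * (\<Sum>w\<in>e. d w))"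
    by (simp_all add: zagreb2_def ReZG3_def d_def)
  \<comment> \<open>With \<open>a\<close>, \<open>b\<close> the endpoint degrees,
    \<open>(a + b)^2\<close> and \<open>(a + b)^3\<close> are split into power sums plus
    \<open>2ab\<close> and \<open>3ab(a + b)\<close>, so that summing over edges yields
    \<open>S\<close>, \<open>zagreb2\<close> and \<open>ReZG3\<close>.\<close>
  have cube: "(s - (\<Sum>w\<in>e. d w)) ^ 3 =
      s ^ 3 - 3 * s ^ 2 * (\<Sum>w\<in>e. d w ^ 1) + 3 * s * (\<Sum>w\<in>e. d w ^ 2) - (\<Sum>w\<in>e. d w ^ 3)
      + 6 * s * (\<Prod>w\<in>e. d w) - 3 * ((\<Prod>w\<in>e. d w) * (\<Sum>w\<in>e. d w))"
    if "e \<in> edges G" for e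
  proof -
    obtain u v where "e = {u, v}" "u \<noteq> v"
      using edge_doubletonE[OF G \<open>e \<in> edges G\<close>] by metis
    then show ?thesis
      by (simp add: algebra_simps power2_eq_square power3_eq_cube)
  qed
  have "verts ?T = verts G <+> edges G"
    by (simp add: total_transformation_def)
  then have "int (F_index ?T) = (\<Sum>v\<in>verts G. int (degree ?T (Inl v)) ^ 3)
      + (\<Sum>e\<in>edges G. int (degree ?T (Inr e)) ^ 3)"
    using G finite_edges[OF G]
    by (simp add: F_index_def sum.Plus finite_simple_graph_def)
  also have "\<dots> = int n * int m ^ 3 + (\<Sum>e\<in>edges G. (s - (\<Sum>w\<in>e. d w)) ^ 3)"
    using assms
    by (simp add: degree_transformation_vertex degree_transformation_edge d_def s_def)
  also have "(\<Sum>e\<in>edges G. (s - (\<Sum>w\<in>e. d w)) ^ 3) =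
      int m * s ^ 3 - 3 * s ^ 2 * S 1 + 3 * s * S 2 - S 3
      + 6 * s * int (zagreb2 G) - 3 * int (ReZG3 G)"
    using assms(4) by (simp add: cube sum.distrib sum_subtractf S_def M2 R flip: sum_distrib_left)
  finally show ?thesis
    by (simp add: indices s_def)
qed

end
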